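(* Let $f$ be a nondecreasing unbounded function from $\mathbb{N}$ to $\mathbb{N}$ with $f(n)=o(n)$. Let $c>1$ be a constant and let $\epsilon$ be an arbitrary small constant in $(0,\sqrt{c}-1)$. Then every randomized $(\sqrt{c}-\epsilon)$-approximation algorithm for the sum problem in $\sum(c,f(n))$ needs $\Omega\!\left(\frac{n}{f(n)}\right)$ time.
   Context: The sum problem: given a list of nonnegative real numbers $a_1,\ldots,a_n$, approximate $\sum_{i=1}^n a_i$. For $k\ge 1$, a real number $s$ is a $k$-approximation for the sum problem $a_1,\ldots,a_n$ if $\frac{1}{k}\sum_{i=1}^n a_i\le s\le k\sum_{i=1}^n a_i$. For a function $f$ and a parameter $c>1$, $\sum(c,f(n))$ denotes the class of sum problems whose input is a list of nonnegative numbers $a_1,\ldots,a_n$ with $\sum_{i=1}^n a_i\in\left[\frac{f(n)}{c},\,c f(n)\right]$. A randomized $k$-approximation algorithm for $\sum(c,f(n))$ is a randomized algorithm that, on every input list in $\sum(c,f(n))$, outputs a $k$-approximation for its sum with probability at least $3/4$. The algorithm is given $n$ and learns about the list only by reading items (at uniformly random positions, or at positions it chooses), each read costing at least one unit of time. "Needs $\Omega(n/f(n))$ time" means that there is a constant $\kappa>0$ such that for all sufficiently large $n$ the worst-case running time, over inputs of length $n$ in $\sum(c,f(n))$ and over the random choices, is at least $\kappa n/f(n)$. *)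

theory Defs
  imports "HOL-Probability.Probability" "HOL-Library.Landau_Symbols"
begin

definition sum_approx :: "real \<Rightarrow> real list \<Rightarrow> real \<Rightarrow> bool" where
  "sum_approx k xs s \<longleftrightarrow> 1 / k * sum_list xs \<le> s \<and> s \<le> k * sum_list xs"

definition sum_class :: "real \<Rightarrow> (nat \<Rightarrow> nat) \<Rightarrow> real list set" where
  "sum_class c f = {xs. (\<forall>x\<in>set xs. 0 \<le> x) \<and>
     real (f (length xs)) / c \<le> sum_list xs \<and> sum_list xs \<le> c * real (f (length xs))}"

text \<open>
  A randomized algorithm is a probabilistic transition system over an arbitrary type of
  internal states. The length of the input fixes the distribution of the initial state; all
  other information about the input comes from read steps. In a step
  \<open>Read P g\<close> the position \<open>i\<close> is drawn from \<open>P\<close> (a point mass for a position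
  chosen by the algorithm, a uniform distribution for a random position), and if \<open>x\<close> is
  the item found there, the next state is drawn from \<open>g i x\<close>. No bound is put on the
  internal computing power, and the transition function may depend arbitrarily on the real
  numbers read.
\<close>

datatype 's action =
    Halt real
  | Compute "'s pmf"
  | Read "nat pmf" "nat \<Rightarrow> real \<Rightarrow> 's pmf"

record 's algorithm =
  start :: "nat \<Rightarrow> 's pmf"
  act :: "'s \<Rightarrow> 's action"

text \<open>Positions are counted from 0. A read outside the list yields 0, which reveals nothing
  since the algorithm knows the length.\<close>

definition item :: "real list \<Rightarrow> nat \<Rightarrow> real" where
  "item xs i = (if i < length xs then xs ! i else 0)"

definition step :: "'s algorithm \<Rightarrow> real list \<Rightarrow> 's \<Rightarrow> 's pmf" where
  "step A xs s = (case act A s of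
      Halt v \<Rightarrow> return_pmf s
    | Compute p \<Rightarrow> p
    | Read P g \<Rightarrow> bind_pmf P (\<lambda>i. g i (item xs i)))"

primrec state_after :: "'s algorithm \<Rightarrow> real list \<Rightarrow> nat \<Rightarrow> 's pmf" where
  "state_after A xs 0 = start A (length xs)"
| "state_after A xs (Suc t) = bind_pmf (state_after A xs t) (step A xs)"

text \<open>Halting states are absorbing, so the probabilities below increase with \<open>t\<close>, and their
  supremum is the probability of ever halting with an output in \<open>V\<close>. Runs that do not
  halt count as failures.\<close>

definition output_prob :: "'s algorithm \<Rightarrow> real list \<Rightarrow> real set \<Rightarrow> real" where
  "output_prob A xs V =
     (SUP t. measure_pmf.prob (state_after A xs t) {s. \<exists>v\<in>V. act A s = Halt v})"

definition sum_approx_algorithm ::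
    "real \<Rightarrow> real \<Rightarrow> (nat \<Rightarrow> nat) \<Rightarrow> 's algorithm \<Rightarrow> bool" where
  "sum_approx_algorithm k c f A \<longleftrightarrow>
     (\<forall>xs\<in>sum_class c f. output_prob A xs {s. sum_approx k xs s} \<ge> 3 / 4)"

text \<open>The runs on an input are the sequences of states that can arise from some outcomes of the
  random choices. Each step taken before halting, a read or an internal one, costs one unit of
  time; a more expensive operation can be padded with \<open>Compute\<close> steps.\<close>

definition runs :: "'s algorithm \<Rightarrow> real list \<Rightarrow> (nat \<Rightarrow> 's) set" where
  "runs A xs = {\<sigma>. \<sigma> 0 \<in> set_pmf (start A (length xs)) \<and>
     (\<forall>t. \<sigma> (Suc t) \<in> set_pmf (step A xs (\<sigma> t)))}"

definition run_time :: "'s algorithm \<Rightarrow> (nat \<Rightarrow> 's) \<Rightarrow> enat" where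
  "run_time A \<sigma> = (INF t\<in>{t. \<exists>v. act A (\<sigma> t) = Halt v}. enat t)"

definition worst_case_time :: "'s algorithm \<Rightarrow> real list set \<Rightarrow> enat" where
  "worst_case_time A X = (SUP xs\<in>X. SUP \<sigma>\<in>runs A xs. run_time A \<sigma>)"

end

theory Submission
  imports Defs
begin

text \<open>
  Compare the constant list with sum \<open>f n\<close> with the \<open>n\<close> lists that arise from it by raising one
  item so that the sum becomes \<open>c f n\<close>. Since \<open>(\<surd>c - \<epsilon>)\<^sup>2 < c\<close>, no output is correct for both
  the constant list and a raised one. Replacing the item at position \<open>j\<close> changes the probability
  of an event by at most the expected number of reads of \<open>j\<close> on the constant list, so this number
  is at least \<open>1/2\<close> for every \<open>j\<close>. Summing over \<open>j\<close>, the running time on the constant list is at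
  least \<open>n/2\<close>, which is at least \<open>n / (2 f n)\<close>.
\<close>

section \<open>Effect of changing one item on the state distributions\<close>

definition halted :: "'s algorithm \<Rightarrow> 's \<Rightarrow> bool" where
  "halted A s \<longleftrightarrow> (\<exists>v. act A s = Halt v)"

text \<open>Integrated over the state distributions and summed over time, this gives the expected
  number of reads of \<open>j\<close>. Values in \<open>ennreal\<close> avoid integrability
  conditions.\<close>

definition read_prob :: "'s algorithm \<Rightarrow> nat \<Rightarrow> 's \<Rightarrow> ennreal" where
  "read_prob A j s = (case act A s of Read P g \<Rightarrow> ennreal (pmf P j) | _ \<Rightarrow> 0)"

lemma step_halted: "halted A s \<Longrightarrow> step A xs s = return_pmf s"
  by (auto simp: halted_def step_def)

lemma read_prob_halted: "halted A s \<Longrightarrow> read_prob A j s = 0"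
  by (auto simp: halted_def read_prob_def)

text \<open>One step reads at most one position. This later turns a sum over positions into a bound
  on time.\<close>

lemma sum_read_prob_le_1: "finite J \<Longrightarrow> (\<Sum>j\<in>J. read_prob A j s) \<le> 1"
proof (cases "act A s")
  case (Read P g)
  assume "finite J"
  then have "(\<Sum>j\<in>J. read_prob A j s) = ennreal (measure_pmf.prob P J)"
    using Read by (simp add: read_prob_def measure_measure_pmf_finite)
  then show ?thesis by simp
qed (auto simp: read_prob_def)

text \<open>The position is drawn from the same \<open>P\<close> on both inputs. Any position other
  than \<open>j\<close> shows the same item, and at \<open>j\<close> the expected value of
  \<open>h\<close> is at most 1, so the excess is at most the probability of drawing
  \<open>j\<close>.\<close>

lemma nn_integral_step_le:
  fixes h :: "'s \<Rightarrow> ennreal"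
  assumes eq: "\<And>i. i \<noteq> j \<Longrightarrow> item ys i = item xs i" and h: "\<And>s. h s \<le> 1"
  shows "(\<integral>\<^sup>+ s'. h s' \<partial>step A ys s) \<le> (\<integral>\<^sup>+ s'. h s' \<partial>step A xs s) + read_prob A j s"
proof (cases "act A s")
  case (Read P g)
  have le1: "(\<integral>\<^sup>+ s'. h s' \<partial>g i x) \<le> 1" for i x
  proof -
    have "(\<integral>\<^sup>+ s'. h s' \<partial>g i x) \<le> (\<integral>\<^sup>+ s'. 1 \<partial>g i x)"
      by (intro nn_integral_mono h)
    then show ?thesis by simp
  qed
  have "(\<integral>\<^sup>+ s'. h s' \<partial>step A ys s) = (\<integral>\<^sup>+ i. \<integral>\<^sup>+ s'. h s' \<partial>g i (item ys i) \<partial>P)"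
    using Read by (simp add: step_def)
  also have "\<dots> \<le> (\<integral>\<^sup>+ i. (\<integral>\<^sup>+ s'. h s' \<partial>g i (item xs i)) + indicator {j} i \<partial>P)"
  proof (intro nn_integral_mono)
    fix i
    show "(\<integral>\<^sup>+ s'. h s' \<partial>g i (item ys i))
        \<le> (\<integral>\<^sup>+ s'. h s' \<partial>g i (item xs i)) + indicator {j} i"
      using le1[of i "item ys i"] eq[of i] by (cases "i = j") (auto intro: add_increasing)
  qed
  also have "\<dots> = (\<integral>\<^sup>+ i. \<integral>\<^sup>+ s'. h s' \<partial>g i (item xs i) \<partial>P) + emeasure P {j}"
    by (subst nn_integral_add) auto
  also have "\<dots> = (\<integral>\<^sup>+ s'. h s' \<partial>step A xs s) + read_prob A j s"
    using Read by (simp add: step_def read_prob_def emeasure_pmf_single)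
  finally show ?thesis .
qed (auto simp: step_def read_prob_def)

text \<open>The induction needs arbitrary test functions \<open>h\<close>, not only indicators, because the test
  function at time \<open>t\<close> is the conditional expectation of the one at time \<open>t + 1\<close>.\<close>

lemma nn_integral_state_after_le:
  fixes h :: "'s \<Rightarrow> ennreal"
  assumes len: "length ys = length xs"
    and eq: "\<And>i. i \<noteq> j \<Longrightarrow> item ys i = item xs i" and h: "\<And>s. h s \<le> 1"
  shows "(\<integral>\<^sup>+ s. h s \<partial>state_after A ys t)
    \<le> (\<integral>\<^sup>+ s. h s \<partial>state_after A xs t)
      + (\<Sum>u<t. \<integral>\<^sup>+ s. read_prob A j s \<partial>state_after A xs u)"
  using h
proof (induction t arbitrary: h)
  case 0
  then show ?case using len by simp
next
  case (Suc t)
  define h' where "h' s = (\<integral>\<^sup>+ s'. h s' \<partial>step A ys s)" for s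
  have h': "h' s \<le> 1" for s
  proof -
    have "h' s \<le> (\<integral>\<^sup>+ s'. 1 \<partial>step A ys s)"
      unfolding h'_def by (intro nn_integral_mono Suc.prems)
    then show ?thesis by simp
  qed
  have "(\<integral>\<^sup>+ s. h s \<partial>state_after A ys (Suc t)) = (\<integral>\<^sup>+ s. h' s \<partial>state_after A ys t)"
    by (simp add: h'_def)
  also have "\<dots> \<le> (\<integral>\<^sup>+ s. h' s \<partial>state_after A xs t)
      + (\<Sum>u<t. \<integral>\<^sup>+ s. read_prob A j s \<partial>state_after A xs u)"
    by (rule Suc.IH[OF h'])
  \<comment> \<open>The first \<open>t\<close> steps now run on \<open>xs\<close>, but
    \<open>h'\<close> still takes the last one on \<open>ys\<close>. Switching that step costs the
    reads of \<open>j\<close> at time \<open>t\<close>.\<close>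
  also have "(\<integral>\<^sup>+ s. h' s \<partial>state_after A xs t)
      \<le> (\<integral>\<^sup>+ s. (\<integral>\<^sup>+ s'. h s' \<partial>step A xs s) + read_prob A j s \<partial>state_after A xs t)"
    unfolding h'_def by (intro nn_integral_mono nn_integral_step_le eq Suc.prems)
  also have "\<dots> = (\<integral>\<^sup>+ s. h s \<partial>state_after A xs (Suc t))
      + (\<integral>\<^sup>+ s. read_prob A j s \<partial>state_after A xs t)"
    by (subst nn_integral_add) auto
  finally show ?case by (simp add: add_ac)
qed

section \<open>Runs and halting times\<close>

text \<open>Links the state distributions to the worst case over runs. A state in the support ends a
  finite path, and the path extends to an infinite run since the support of a \<open>pmf\<close> is
  never empty.\<close>

lemma run_through_state:
  assumes "s \<in> set_pmf (state_after A xs t)"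
  shows "\<exists>\<sigma>\<in>runs A xs. \<sigma> t = s"
proof -
  have "\<exists>\<sigma>. \<sigma> 0 \<in> set_pmf (start A (length xs)) \<and>
      (\<forall>i<t. \<sigma> (Suc i) \<in> set_pmf (step A xs (\<sigma> i))) \<and> \<sigma> t = s"
    using assms
  proof (induction t arbitrary: s)
    case 0
    then show ?case by (intro exI[of _ "\<lambda>_. s"]) auto
  next
    case (Suc t)
    then obtain r where r: "r \<in> set_pmf (state_after A xs t)" "s \<in> set_pmf (step A xs r)"
      by auto
    from Suc.IH[OF r(1)] obtain \<sigma> where
      "\<sigma> 0 \<in> set_pmf (start A (length xs))"
      "\<forall>i<t. \<sigma> (Suc i) \<in> set_pmf (step A xs (\<sigma> i))" "\<sigma> t = r" by blast
    with r(2) show ?case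
      by (intro exI[of _ "\<sigma>(Suc t := s)"]) (auto simp: less_Suc_eq)
  qed
  then obtain \<sigma> where \<sigma>: "\<sigma> 0 \<in> set_pmf (start A (length xs))"
    "\<And>i. i < t \<Longrightarrow> \<sigma> (Suc i) \<in> set_pmf (step A xs (\<sigma> i))" "\<sigma> t = s" by blast
  define next_state where "next_state r = (SOME q. q \<in> set_pmf (step A xs r))" for r
  have next_state: "next_state r \<in> set_pmf (step A xs r)" for r
    unfolding next_state_def using set_pmf_not_empty[of "step A xs r"] by (simp add: some_in_eq)
  \<comment> \<open>The values of \<open>\<sigma>\<close> beyond \<open>t\<close> are arbitrary, so
    they are replaced by iterated choices of a successor starting from \<open>s\<close>.\<close>
  define \<tau> where "\<tau> i = (if i \<le> t then \<sigma> i else (next_state ^^ (i - t)) s)" for i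
  have "\<tau> (Suc i) \<in> set_pmf (step A xs (\<tau> i))" for i
  proof (cases "i < t")
    case True
    then show ?thesis using \<sigma>(2) by (simp add: \<tau>_def)
  next
    case False
    then have "\<tau> (Suc i) = next_state (\<tau> i)"
      using \<sigma>(3) by (auto simp: \<tau>_def Suc_diff_le)
    then show ?thesis using next_state by simp
  qed
  moreover have "\<tau> 0 = \<sigma> 0" "\<tau> t = s" using \<sigma>(3) by (auto simp: \<tau>_def)
  ultimately have "\<tau> \<in> runs A xs" "\<tau> t = s"
    using \<sigma>(1) by (simp_all add: runs_def)
  then show ?thesis by blast
qed

lemma run_halted_mono:
  assumes "\<sigma> \<in> runs A xs" "halted A (\<sigma> t)" "t \<le> u"
  shows "halted A (\<sigma> u)"
  using assms(3)
proof (induction u rule: dec_induct)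
  case base
  show ?case by (fact assms(2))
next
  case (step u)
  have "\<sigma> (Suc u) \<in> set_pmf (Defs.step A xs (\<sigma> u))"
    using assms(1) by (simp add: runs_def)
  then show ?case using step.IH by (simp add: step_halted)
qed

lemma halted_if_run_time_le:
  assumes "run_time A \<sigma> \<le> enat T" "\<sigma> \<in> runs A xs"
  shows "halted A (\<sigma> T)"
proof -
  \<comment> \<open>A strict bound on the infimum yields an actual halting time at most
    \<open>T\<close>; for a run that never halts the infimum would be infinite.\<close>
  have "run_time A \<sigma> < enat (Suc T)"
    using assms(1) by (metis enat_ord_simps(2) lessI order.strict_trans1)
  then obtain t where "halted A (\<sigma> t)" "t \<le> T"
    unfolding run_time_def halted_def by (auto simp: INF_less_iff less_Suc_eq_le)
  then show ?thesis using run_halted_mono assms(2) by blast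
qed

text \<open>The worst-case bound covers every run, and every state in the support lies on a run;
  once halted, a run stays halted.\<close>

lemma state_after_halted:
  assumes "worst_case_time A X \<le> enat T" "xs \<in> X"
    and "s \<in> set_pmf (state_after A xs t)" "T \<le> t"
  shows "halted A s"
proof -
  obtain \<sigma> where \<sigma>: "\<sigma> \<in> runs A xs" "\<sigma> t = s"
    using run_through_state[OF assms(3)] by blast
  have "run_time A \<sigma> \<le> worst_case_time A X"
    unfolding worst_case_time_def using assms(2) \<sigma>(1) by (meson SUP_upper2 order_refl)
  then have "halted A (\<sigma> T)"
    using halted_if_run_time_le \<sigma>(1) assms(1) order_trans by blast
  then show ?thesis
    using run_halted_mono \<sigma> assms(4) by blast
qed

section \<open>Output probabilities and expected reads\<close>

text \<open>Halting states are absorbing, so the probabilities increase and their supremum is a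
  limit. Inequalities proved for all large \<open>t\<close> then carry over to
  \<open>output_prob\<close>.\<close>

lemma output_prob_LIMSEQ:
  "(\<lambda>t. measure_pmf.prob (state_after A xs t) {s. \<exists>v\<in>V. act A s = Halt v})
    \<longlonglongrightarrow> output_prob A xs V"
proof -
  let ?W = "{s. \<exists>v\<in>V. act A s = Halt v}"
  have "emeasure (state_after A xs t) ?W \<le> emeasure (state_after A xs (Suc t)) ?W" for t
  proof -
    have "emeasure (state_after A xs t) ?W = (\<integral>\<^sup>+ s. indicator ?W s \<partial>state_after A xs t)"
      by simp
    also have "\<dots> \<le> (\<integral>\<^sup>+ s. emeasure (step A xs s) ?W \<partial>state_after A xs t)"
      by (intro nn_integral_mono) (auto simp: indicator_def step_def)
    also have "\<dots> = emeasure (state_after A xs (Suc t)) ?W"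
      by simp
    finally show ?thesis .
  qed
  then have "incseq (\<lambda>t. measure_pmf.prob (state_after A xs t) ?W)"
    by (intro incseq_SucI) (simp add: measure_pmf.emeasure_eq_measure)
  moreover have "bdd_above (range (\<lambda>t. measure_pmf.prob (state_after A xs t) ?W))"
    by (rule bdd_aboveI[of _ 1]) auto
  ultimately show ?thesis
    unfolding output_prob_def by (intro LIMSEQ_incseq_SUP)
qed

text \<open>On \<open>xs\<close> alone the two output events are disjoint, so their probabilities
  add up to at most 1. Passing to \<open>ys\<close> in the second event adds at most the expected
  reads of \<open>j\<close> on \<open>xs\<close>.\<close>

lemma expected_reads_ge_output_prob:
  assumes len: "length ys = length xs"
    and eq: "\<And>i. i \<noteq> j \<Longrightarrow> item ys i = item xs i"
    and halt: "\<And>s t. T \<le> t \<Longrightarrow> s \<in> set_pmf (state_after A xs t) \<Longrightarrow> halted A s"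
    and disj: "V \<inter> W = {}"
  shows "ennreal (output_prob A xs V + output_prob A ys W)
    \<le> 1 + (\<Sum>u<T. \<integral>\<^sup>+ s. read_prob A j s \<partial>state_after A xs u)" (is "_ \<le> 1 + ?R")
proof -
  let ?E = "\<lambda>V. {s. \<exists>v\<in>V. act A s = Halt v}"
  let ?p = "\<lambda>zs t V. measure_pmf.prob (state_after A zs t) (?E V)"
  \<comment> \<open>All \<open>t\<close> from \<open>T\<close> on are needed for the limit, as runs
    on \<open>ys\<close> may halt after time \<open>T\<close>. The bound \<open>?R\<close> stays
    fixed because halted states on \<open>xs\<close> read nothing.\<close>
  have "ennreal (?p xs t V + ?p ys t W) \<le> 1 + ?R" if "T \<le> t" for t
  proof -
    have "(\<integral>\<^sup>+ s. read_prob A j s \<partial>state_after A xs u) = 0" if "T \<le> u" for u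
      using halt[OF that]
      by (auto simp: nn_integral_0_iff_AE AE_measure_pmf_iff read_prob_halted)
    then have R: "(\<Sum>u<t. \<integral>\<^sup>+ s. read_prob A j s \<partial>state_after A xs u) = ?R"
      using \<open>T \<le> t\<close> by (intro sum.mono_neutral_right) auto
    have "?E V \<inter> ?E W = {}"
      using disj by auto
    then have "?p xs t V + ?p xs t W = measure_pmf.prob (state_after A xs t) (?E V \<union> ?E W)"
      by (subst measure_pmf.finite_measure_Union) auto
    then have le1: "?p xs t V + ?p xs t W \<le> 1"
      by simp
    have "ennreal (?p ys t W) = (\<integral>\<^sup>+ s. indicator (?E W) s \<partial>state_after A ys t)"
      by (simp add: measure_pmf.emeasure_eq_measure)
    also have "\<dots> \<le> (\<integral>\<^sup>+ s. indicator (?E W) s \<partial>state_after A xs t) + ?R"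
      unfolding R[symmetric]
      by (intro nn_integral_state_after_le len eq) (auto simp: indicator_def)
    also have "\<dots> = ennreal (?p xs t W) + ?R"
      by (simp add: measure_pmf.emeasure_eq_measure)
    finally have "ennreal (?p xs t V + ?p ys t W) \<le> ennreal (?p xs t V + ?p xs t W) + ?R"
      by (simp add: ennreal_plus add_left_mono add.assoc)
    also have "\<dots> \<le> 1 + ?R"
      using ennreal_leI[OF le1] by (intro add_right_mono) simp
    finally show ?thesis .
  qed
  moreover have "(\<lambda>t. ennreal (?p xs t V + ?p ys t W))
      \<longlonglongrightarrow> ennreal (output_prob A xs V + output_prob A ys W)"
    by (intro tendsto_ennrealI tendsto_add output_prob_LIMSEQ)
  ultimately show ?thesis
    by (intro LIMSEQ_le_const2) auto
qed

text \<open>Each position is read at least \<open>3/4 + 3/4 - 1 = 1/2\<close> times in expectation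
  on \<open>xs\<close>, while each of at most \<open>T\<close> steps reads at most one position. If
  the worst-case time is infinite, the claim is immediate.\<close>

lemma worst_case_time_ge_half_length:
  fixes W :: "nat \<Rightarrow> real set"
  assumes X: "xs \<in> X" and V: "3 / 4 \<le> output_prob A xs V"
    and len: "\<And>j. j < n \<Longrightarrow> length (ys j) = length xs"
    and eq: "\<And>i j. j < n \<Longrightarrow> i \<noteq> j \<Longrightarrow> item (ys j) i = item xs i"
    and W: "\<And>j. j < n \<Longrightarrow> 3 / 4 \<le> output_prob A (ys j) (W j)"
    and disj: "\<And>j. j < n \<Longrightarrow> V \<inter> W j = {}"
  shows "ereal (real n / 2) \<le> ereal_of_enat (worst_case_time A X)"
proof (cases "worst_case_time A X")
  case (enat T)
  let ?R = "\<lambda>j. \<Sum>u<T. \<integral>\<^sup>+ s. read_prob A j s \<partial>state_after A xs u"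
  have halt: "halted A s" if "T \<le> t" "s \<in> set_pmf (state_after A xs t)" for s t
    using state_after_halted[OF _ X that(2) that(1)] enat by simp
  have each: "ennreal (3 / 2) \<le> 1 + ?R j" if "j < n" for j
  proof -
    have "ennreal (3 / 2) \<le> ennreal (output_prob A xs V + output_prob A (ys j) (W j))"
      using V W[OF that] by (intro ennreal_leI) simp
    also have "\<dots> \<le> 1 + ?R j"
      using that by (intro expected_reads_ge_output_prob len eq halt disj)
    finally show ?thesis .
  qed
  have "ennreal (real n * (3 / 2)) = (\<Sum>j<n. ennreal (3 / 2))"
    by (simp add: ennreal_of_nat_eq_real_of_nat flip: ennreal_mult)
  also have "\<dots> \<le> (\<Sum>j<n. 1 + ?R j)"
    using each by (intro sum_mono) simp
  \<comment> \<open>Exchanging the sums over positions and times allows the bound of one read per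
    step to be applied under the integral.\<close>
  also have "\<dots> = of_nat n + (\<Sum>u<T. \<integral>\<^sup>+ s. (\<Sum>j<n. read_prob A j s) \<partial>state_after A xs u)"
    by (subst nn_integral_sum) (auto simp: sum.distrib intro: sum.swap)
  also have "\<dots> \<le> of_nat n + (\<Sum>u<T. \<integral>\<^sup>+ s. 1 \<partial>state_after A xs u)"
    by (intro add_left_mono sum_mono nn_integral_mono sum_read_prob_le_1) simp
  also have "\<dots> = ennreal (real n + real T)"
    by (simp add: ennreal_of_nat_eq_real_of_nat)
  finally have "real n * (3 / 2) \<le> real n + real T"
    by (subst (asm) ennreal_le_iff) auto
  then show ?thesis using enat by simp
qed simp

section \<open>The hard inputs and the lower bound\<close>

text \<open>With \<open>S = sum_list xs\<close>, correct outputs for \<open>xs\<close> are at most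
  \<open>k * S\<close>, those for \<open>ys\<close> at least \<open>c * S / k\<close>, and
  \<open>k\<^sup>2 < c\<close> separates the two bounds.\<close>

lemma sum_approx_disjoint:
  assumes k: "0 < k" "k\<^sup>2 < c" and "0 < sum_list xs" "sum_list ys = c * sum_list xs"
  shows "{s. sum_approx k xs s} \<inter> {s. sum_approx k ys s} = {}"
proof -
  have "k * sum_list xs < c * sum_list xs / k"
    using assms by (simp add: field_simps power2_eq_square)
  then show ?thesis
    using assms(4) by (auto simp: sum_approx_def)
qed

theorem theorem6:
  fixes f :: "nat \<Rightarrow> nat" and c \<epsilon> :: real and A :: "'s algorithm"
  assumes "mono f"
    and "\<not> bdd_above (range f)"
    and "(\<lambda>n. real (f n)) \<in> o(\<lambda>n. real n)"
    and "c > 1"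
    and "0 < \<epsilon>" and "\<epsilon> < sqrt c - 1"
    and "sum_approx_algorithm (sqrt c - \<epsilon>) c f A"
  shows "\<exists>\<kappa>>0. \<forall>\<^sub>F n in sequentially.
    ereal (\<kappa> * (real n / real (f n)))
      \<le> ereal_of_enat (worst_case_time A {xs \<in> sum_class c f. length xs = n})"
\<comment> \<open>The constant \<open>1 / 2\<close> works for every \<open>n\<close>, not only for
  large ones.\<close>
proof (intro exI[of _ "1 / 2"] conjI always_eventually allI)
  fix n
  let ?k = "sqrt c - \<epsilon>" and ?X = "{xs \<in> sum_class c f. length xs = n}"
  show "ereal (1 / 2 * (real n / real (f n))) \<le> ereal_of_enat (worst_case_time A ?X)"
  \<comment> \<open>Here division by zero gives 0, so the left side vanishes in both degenerate
    cases.\<close>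
  proof (cases "n = 0 \<or> f n = 0")
    case True
    then show ?thesis using ereal_of_enat_nonneg by (auto simp: zero_ereal_def[symmetric])
  next
    case False
    then have n: "0 < n" and f: "1 \<le> real (f n)" by auto
    define x where "x = real (f n) / real n"
    define xs where "xs = replicate n x"
    \<comment> \<open>The increment lifts the sum from \<open>f n\<close> to \<open>c * f n\<close>,
      the largest value that the class allows.\<close>
    define ys where "ys j = xs[j := x + (c - 1) * real (f n)]" for j
    have x: "0 \<le> x" by (simp add: x_def)
    have sum_xs: "sum_list xs = real (f n)"
      using n by (simp add: xs_def x_def sum_list_replicate)
    have sum_ys: "sum_list (ys j) = c * real (f n)" if "j < n" for j
    proof -
      have "xs = take j xs @ x # drop (Suc j) xs"
        using that id_take_nth_drop[of j xs] by (simp add: xs_def)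
      then have "sum_list xs = sum_list (take j xs) + (x + sum_list (drop (Suc j) xs))"
        by (metis sum_list.Cons sum_list.append)
      then show ?thesis
        using that sum_xs by (simp add: ys_def upd_conv_take_nth_drop xs_def algebra_simps)
    qed
    have xs_X: "xs \<in> ?X"
      using \<open>c > 1\<close> f x sum_xs by (auto simp: sum_class_def xs_def field_simps)
    have ys_class: "ys j \<in> sum_class c f" if "j < n" for j
    proof -
      have "0 \<le> z" if "z \<in> set (ys j)" for z
        using that set_update_subset_insert[of xs j] \<open>c > 1\<close> x
        by (fastforce simp: ys_def xs_def)
      moreover have "real (f n) / c \<le> c * real (f n)"
      proof -
        have "real (f n) \<le> c * c * real (f n)"
          using \<open>c > 1\<close> f mult_right_mono[of 1 "c * c" "real (f n)"]
            mult_mono[of 1 c 1 c] by simp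
        then show ?thesis using \<open>c > 1\<close> by (simp add: field_simps)
      qed
      moreover have "length (ys j) = n"
        by (simp add: ys_def xs_def)
      ultimately show ?thesis
        using sum_ys[OF that] by (simp add: sum_class_def)
    qed
    \<comment> \<open>Positivity comes from \<open>\<epsilon> < sqrt c - 1\<close>, and strictness
      below \<open>c\<close> from \<open>0 < \<epsilon>\<close>.\<close>
    have k: "0 < ?k" "?k\<^sup>2 < c"
    proof -
      show "0 < ?k" using assms(6) by simp
      then have "?k\<^sup>2 < (sqrt c)\<^sup>2"
        using \<open>0 < \<epsilon>\<close> by (intro power_strict_mono) auto
      then show "?k\<^sup>2 < c" using \<open>c > 1\<close> by simp
    qed
    have "real n / real (f n) \<le> real n"
      using f mult_left_mono[OF f, of "real n"] by (simp add: field_simps)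
    then have "ereal (1 / 2 * (real n / real (f n))) \<le> ereal (real n / 2)"
      by simp
    also have "\<dots> \<le> ereal_of_enat (worst_case_time A ?X)"
    proof (rule worst_case_time_ge_half_length)
      show "xs \<in> ?X" by (fact xs_X)
      show "3 / 4 \<le> output_prob A xs {s. sum_approx ?k xs s}"
        using assms(7) xs_X by (auto simp: sum_approx_algorithm_def)
      show "3 / 4 \<le> output_prob A (ys j) {s. sum_approx ?k (ys j) s}" if "j < n" for j
        using assms(7) ys_class[OF that] by (auto simp: sum_approx_algorithm_def)
      show "length (ys j) = length xs" for j
        by (simp add: ys_def)
      show "item (ys j) i = item xs i" if "i \<noteq> j" for i j
        using that by (simp add: item_def ys_def)
      show "{s. sum_approx ?k xs s} \<inter> {s. sum_approx ?k (ys j) s} = {}" if "j < n" for j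
        using k f sum_xs sum_ys[OF that] by (intro sum_approx_disjoint) auto
    qed
    finally show ?thesis .
  qed
qed simp

end
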